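(* Let $K$ be an algebraically closed $b$-complete idempotent semifield, let $V\neq\{\mathbf 0\}$ be an Archimedean idempotent space over $K$, and let $G$ be a nilpotent abstract group. Then every linear representation $\pi:G\to\mathrm{End}(V)$ has a joint eigenvector; that is, there exist a nonzero $a\in V$ and a function $\lambda:G\to K$ such that $\pi(g)a=\lambda(g)\odot a$ for all $g\in G$.
   Context: **Semifields.** A semiring is a set with associative operations $\oplus$ (commutative) and $\odot$, with $\odot$ distributing over $\oplus$ on both sides. A zero is an element $\mathbf 0$ with $\mathbf 0\oplus x=x$ and $\mathbf 0\odot x=x\odot\mathbf 0=\mathbf 0$ for all $x$; a unity is an element $\mathbf 1$ with $\mathbf 1\odot x=x\odot\mathbf 1=x$ for all $x$; $\mathbf 0\ne\mathbf 1$. A semiring is idempotent if $x\oplus x=x$ for all $x$. A semifield is a semiring with $\mathbf 0$ and $\mathbf 1$ in which every nonzero element is invertible with respect to $\odot$. A semiring $K$ is algebraically closed if for every $x\in K$ and every integer $n\ge1$ there is $y\in K$ with $y^n=x$ (power with respect to $\odot$). **Order and completeness.** An idempotent semigroup is a commutative semigroup with idempotent operation $\oplus$; it is partially ordered by $x\preccurlyeq y\iff x\oplus y=y$, so that $x\oplus y=\sup\{x,y\}$. For a subset $X$ write $\oplus X=\sup X$ and $\wedge X=\inf X$ when they exist. "Bounded" means bounded from above. The semigroup is $b$-complete if every bounded subset, including $\varnothing$, has a least upper bound; its zero is $\mathbf 0=\oplus\varnothing$. An idempotent semifield is $b$-complete if its additive semigroup is. **$b$-spaces.** An idempotent space over an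 idempotent semifield $K$ is an idempotent semigroup $V$ with a multiplication $\odot:K\times V\to V$ such that, for all $a,b\in K$, $x,y\in V$: $a\odot(b\odot x)=(a\odot b)\odot x$, $(a\oplus b)\odot x=a\odot x\oplus b\odot x$, $a\odot(x\oplus y)=a\odot x\oplus a\odot y$, $\mathbf 0\odot x=\mathbf 0$, $\mathbf 1\odot x=x$. For $K$ $b$-complete, a $b$-complete idempotent space $V$ is an idempotent $b$-space if for every nonempty bounded $Q\subset K$ and every $x\in V$: $(\oplus Q)\odot x=\oplus(Q\odot x)$ and $(\wedge Q)\odot x=\wedge(Q\odot x)$. A $b$-linear operator between $b$-spaces is a map $f$ preserving $\oplus$ and multiplication by elements of $K$ and satisfying $f(\oplus X)=\oplus f(X)$ for every bounded subset $X$. **Archimedean spaces.** A nondecreasing map $f$ between $b$-spaces is $wo$-continuous if $f(\oplus X)=\oplus f(X)$ and $f(\wedge X)=\wedge f(X)$ for every nonempty bounded linearly ordered subset $X$. An element $x\in V$ is Archimedean if for every $y\in V$ there is $\lambda\in K$ with $y\preccurlyeq\lambda\odot x$; for such $x$ define $x^*:V\to K$ by $x^*(y)=\wedge\{k\in K\mid y\preccurlyeq k\odot x\}$. The Archimedean element $x$ is $wo$-continuous if $x^*$ is $wo$-continuous ($K$ is regarded as a $b$-space over itself). An idempotent $b$-space $V$ is called Archimedean (an Archimedean idempotent space) if it contains a $wo$-continuous Archimedean element. **Representations.** $\mathrm{End}(V)$ is the set of all $b$-linear operators $V\to V$. A linear representation of a group $G$ in an Archimedean space $V$ is a group homomorphism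 $\pi$ from $G$ to the group of invertible elements of $\mathrm{End}(V)$ (with respect to composition). **Nilpotent groups.** With $[a,b]=a^{-1}b^{-1}ab$ and $[X,Y]$ the subgroup generated by $\{[x,y]\mid x\in X,\,y\in Y\}$, put $\Gamma_1(G)=G$ and $\Gamma_i(G)=[G,\Gamma_{i-1}(G)]$ for $i\ge2$; $G$ is nilpotent if $\Gamma_n(G)=\{e\}$ for some positive integer $n$. *)

theory Defs
  imports "HOL-Algebra.Generated_Groups" Complex_Main
begin

section \<open>Idempotent semigroups and semifields\<close>

class idempotent_semigroup = ab_semigroup_add + order +
  assumes add_idem: "x + x = x"
    and le_iff_add_eq: "x \<le> y \<longleftrightarrow> x + y = y"

text \<open>
  The operations \<open>Sup\<close> and \<open>Inf\<close> are determined by the addition on all nonempty sets that are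
  bounded above (below); the lemma \<open>b_complete_semigroup_exists\<close> shows that requiring them is
  no restriction on an idempotent semigroup in which all bounded subsets have suprema.
  Neutrality of \<open>0\<close> says that \<open>0\<close> is the least element, i.e. the supremum of the
  empty set; \<open>Sup_empty_eq\<close> only fixes the value of \<open>Sup {}\<close>, which is left unspecified in
  a conditionally complete lattice.
\<close>

class b_complete_semigroup = idempotent_semigroup + comm_monoid_add + conditionally_complete_lattice +
  assumes Sup_empty_eq: "Sup {} = 0"

lemma b_complete_semigroup_exists:
  fixes add :: "'a \<Rightarrow> 'a \<Rightarrow> 'a" and below :: "'a \<Rightarrow> 'a \<Rightarrow> bool"
  assumes below_def: "\<And>x y. below x y \<longleftrightarrow> add x y = y"
    and assoc: "\<And>x y z. add (add x y) z = add x (add y z)"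
    and comm: "\<And>x y. add x y = add y x"
    and idem: "\<And>x. add x x = x"
    and complete: "\<And>X. \<exists>u. \<forall>x\<in>X. below x u \<Longrightarrow>
      \<exists>s. (\<forall>x\<in>X. below x s) \<and> (\<forall>u. (\<forall>x\<in>X. below x u) \<longrightarrow> below s u)"
  shows "\<exists>zero Sup Inf inf.
    class.b_complete_semigroup Inf Sup inf below (\<lambda>x y. below x y \<and> x \<noteq> y) add add zero"
proof -
  have refl: "below x x" for x
    by (simp add: below_def idem)
  have trans: "below x z" if "below x y" "below y z" for x y z
    using that assoc unfolding below_def by metis
  have antisym: "x = y" if "below x y" "below y x" for x y
    using that comm unfolding below_def by metis
  have add_upper: "below x (add x y)" "below y (add x y)" for x y
    using assoc comm idem unfolding below_def by metis+
  have add_least: "below (add x y) z" if "below x z" "below y z" for x y z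
    using that assoc unfolding below_def by metis
  define lub where "lub X = (SOME s. (\<forall>x\<in>X. below x s) \<and>
    (\<forall>u. (\<forall>x\<in>X. below x u) \<longrightarrow> below s u))" for X
  have lub: "(\<forall>x\<in>X. below x (lub X)) \<and> (\<forall>u. (\<forall>x\<in>X. below x u) \<longrightarrow> below (lub X) u)"
    if "\<forall>x\<in>X. below x v" for X v
    unfolding lub_def by (rule someI_ex) (use complete that in blast)
  define glb where "glb X = lub {l. \<forall>x\<in>X. below l x}" for X
  have glb_lower: "below (glb X) x" if "x \<in> X" for X x
    using lub[of "{l. \<forall>x\<in>X. below l x}" x] that unfolding glb_def by blast
  have glb_greatest: "below z (glb X)" if "X \<noteq> {}" "\<And>x. x \<in> X \<Longrightarrow> below z x" for X z
  proof -
    obtain x where "x \<in> X"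
      using \<open>X \<noteq> {}\<close> by blast
    then show ?thesis
      using lub[of "{l. \<forall>x\<in>X. below l x}" x] that unfolding glb_def by blast
  qed
  have least: "below (lub {}) x" for x
    using lub[of "{}"] by blast
  have "class.order below (\<lambda>x y. below x y \<and> x \<noteq> y)"
    by unfold_locales (blast intro: refl trans antisym)+
  then interpret o: order below "\<lambda>x y. below x y \<and> x \<noteq> y" .
  have "class.b_complete_semigroup glb lub (\<lambda>x y. glb {x, y}) below
    (\<lambda>x y. below x y \<and> x \<noteq> y) add add (lub {})"
  proof
    show "below x (lub X)" if "x \<in> X" "o.bdd_above X" for x X
      using that lub[of X] unfolding o.bdd_above_def by blast
    show "below (lub X) z" if "X \<noteq> {}" "\<And>x. x \<in> X \<Longrightarrow> below x z" for X z
      using that lub[of X z] by blast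
    show "below x y \<longleftrightarrow> add x y = y" for x y
      by (rule below_def)
    show "add (lub {}) x = x" for x
      using least[of x] by (simp add: below_def)
  qed (auto intro: glb_lower glb_greatest add_upper add_least assoc comm idem)
  then show ?thesis
    by blast
qed

class idempotent_semifield = semiring_1 + idempotent_semigroup +
  assumes invertible: "x \<noteq> 0 \<Longrightarrow> \<exists>y. x * y = 1 \<and> y * x = 1"

class b_complete_semifield = idempotent_semifield + b_complete_semigroup

class algebraically_closed_semiring = semiring_1 +
  assumes root_exists: "1 \<le> n \<Longrightarrow> \<exists>y. y ^ n = x"


section \<open>Idempotent b-spaces\<close>

locale idempotent_b_space =
  fixes scale :: "'k::b_complete_semifield \<Rightarrow> 'v::b_complete_semigroup \<Rightarrow> 'v"
  assumes scale_scale: "scale a (scale b x) = scale (a * b) x"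
    and scale_left_distrib: "scale (a + b) x = scale a x + scale b x"
    and scale_right_distrib: "scale a (x + y) = scale a x + scale a y"
    and scale_zero_left: "scale 0 x = 0"
    and scale_one: "scale 1 x = x"
    and Sup_scale: "Q \<noteq> {} \<Longrightarrow> bdd_above Q \<Longrightarrow> scale (Sup Q) x = Sup ((\<lambda>q. scale q x) ` Q)"
    and Inf_scale: "Q \<noteq> {} \<Longrightarrow> bdd_above Q \<Longrightarrow> scale (Inf Q) x = Inf ((\<lambda>q. scale q x) ` Q)"

text \<open>Here \<open>X\<close> may be empty.\<close>

definition b_linear ::
    "('k \<Rightarrow> 'v \<Rightarrow> 'v) \<Rightarrow> ('k \<Rightarrow> 'w \<Rightarrow> 'w) \<Rightarrow> ('v::b_complete_semigroup \<Rightarrow> 'w::b_complete_semigroup) \<Rightarrow> bool"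
  where "b_linear scale1 scale2 f \<longleftrightarrow>
    (\<forall>x y. f (x + y) = f x + f y) \<and>
    (\<forall>a x. f (scale1 a x) = scale2 a (f x)) \<and>
    (\<forall>X. bdd_above X \<longrightarrow> f (Sup X) = Sup (f ` X))"

definition wo_continuous :: "('v::b_complete_semigroup \<Rightarrow> 'w::b_complete_semigroup) \<Rightarrow> bool"
  where "wo_continuous f \<longleftrightarrow> mono f \<and>
    (\<forall>X. X \<noteq> {} \<and> bdd_above X \<and> Complete_Partial_Order.chain (\<le>) X \<longrightarrow>
      f (Sup X) = Sup (f ` X) \<and> f (Inf X) = Inf (f ` X))"

context idempotent_b_space
begin

definition archimedean_element :: "'v \<Rightarrow> bool"
  where "archimedean_element x \<longleftrightarrow> (\<forall>y. \<exists>k. y \<le> scale k x)"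

definition star :: "'v \<Rightarrow> 'v \<Rightarrow> 'k"
  where "star x y = Inf {k. y \<le> scale k x}"

definition wo_continuous_archimedean_element :: "'v \<Rightarrow> bool"
  where "wo_continuous_archimedean_element x \<longleftrightarrow> archimedean_element x \<and> wo_continuous (star x)"

end

locale archimedean_b_space = idempotent_b_space +
  assumes ex_wo_continuous_archimedean: "\<exists>x. wo_continuous_archimedean_element x"


section \<open>Linear representations\<close>

definition End :: "('k \<Rightarrow> 'v \<Rightarrow> 'v) \<Rightarrow> ('v::b_complete_semigroup \<Rightarrow> 'v) monoid"
  where "End scale = \<lparr>carrier = {f. b_linear scale scale f}, mult = (\<circ>), one = id\<rparr>"

definition linear_representation ::
    "('g, 'm) monoid_scheme \<Rightarrow> ('k \<Rightarrow> 'v \<Rightarrow> 'v) \<Rightarrow> ('g \<Rightarrow> 'v::b_complete_semigroup \<Rightarrow> 'v) \<Rightarrow> bool"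
  where "linear_representation G scale \<pi> \<longleftrightarrow> \<pi> \<in> hom G (units_of (End scale))"


section \<open>Nilpotent groups\<close>

definition commutator_subgroup :: "('g, 'm) monoid_scheme \<Rightarrow> 'g set \<Rightarrow> 'g set \<Rightarrow> 'g set"
  where "commutator_subgroup G X Y =
    generate G {inv\<^bsub>G\<^esub> x \<otimes>\<^bsub>G\<^esub> inv\<^bsub>G\<^esub> y \<otimes>\<^bsub>G\<^esub> x \<otimes>\<^bsub>G\<^esub> y | x y. x \<in> X \<and> y \<in> Y}"

text \<open>The indexing starts at 0, so \<open>lower_central G n\<close> is the term usually written
  \<open>\<Gamma>\<close> with index \<open>n + 1\<close>.\<close>

primrec lower_central :: "('g, 'm) monoid_scheme \<Rightarrow> nat \<Rightarrow> 'g set"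
  where
    "lower_central G 0 = carrier G"
  | "lower_central G (Suc n) = commutator_subgroup G (carrier G) (lower_central G n)"

definition nilpotent_group :: "('g, 'm) monoid_scheme \<Rightarrow> bool"
  where "nilpotent_group G \<longleftrightarrow> group G \<and> (\<exists>n. lower_central G n = {\<one>\<^bsub>G\<^esub>})"

end

theory Submission
  imports Defs
begin

text \<open>
  Let \<open>e\<close> be a \<open>wo\<close>-continuous Archimedean element. Since \<open>star e\<close> commutes with infima of chains,
  Zorn's lemma gives a minimal nonzero closed \<open>G\<close>-invariant subspace \<open>W\<close>, and \<open>W\<close> has a largest
  element \<open>a\<close> with \<open>star e a = 1\<close>. If \<open>\<pi> h\<close> commutes on \<open>W\<close> with the whole representation, then by
  minimality \<open>\<pi> h \<le> t\<close> on \<open>W\<close> for every \<open>t\<close> with \<open>t\<^sup>n = star e (h\<^sup>n a)\<close>; for the infimum \<open>l\<close> of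
  all upper bounds, \<open>l\<^sup>-\<^sup>n h\<^sup>n a\<close> decreases to a nonzero vector \<open>b\<close> with \<open>\<pi> h b = l b\<close>, so \<open>\<pi> h\<close> is the
  scalar \<open>l\<close> on \<open>W\<close>. If all commutators of \<open>h\<close> with elements of \<open>G\<close> act on \<open>W\<close> by scalars, these
  scalars have bounded powers and hence equal \<open>1\<close>, so \<open>\<pi> h\<close> does commute with the representation.
  Descending the lower central series, all of \<open>G\<close> acts on \<open>W\<close> by scalars.
\<close>

section \<open>Idempotent semigroups and semifields\<close>

text \<open>The class has \<open>+\<close> and \<open>sup\<close> as separate operations tied only
  through the order; identifying them makes lattice lemmas available for sums.\<close>

lemma add_eq_sup: "x + y = sup x (y::'a::b_complete_semigroup)"
proof (rule order.antisym)
  have "x \<le> x + y" "y \<le> x + y"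
    by (simp_all add: le_iff_add_eq add_idem ac_simps add.left_commute)
      (metis add.assoc add_idem add.commute)+
  then show "sup x y \<le> x + y" by simp
  have "x + sup x y = sup x y" "y + sup x y = sup x y"
    by (simp_all flip: le_iff_add_eq)
  then show "x + y \<le> sup x y"
    by (simp add: le_iff_add_eq add.assoc)
qed

lemma zero_least [simp]: "(0::'a::b_complete_semigroup) \<le> x"
  by (simp add: le_iff_add_eq)

lemma bdd_below_zero [simp]: "bdd_below (X :: 'a::b_complete_semigroup set)"
  by (rule bdd_belowI[of _ 0]) simp

lemma eq_zero_if_le [simp]: "x \<le> (0::'a::b_complete_semigroup) \<longleftrightarrow> x = 0"
  using zero_least by (metis order.antisym order.refl)

lemma mult_left_mono_idem: "a \<le> b \<Longrightarrow> c * a \<le> c * (b::'k::b_complete_semifield)"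
  by (metis le_iff_add_eq distrib_left)

lemma mult_right_mono_idem: "a \<le> b \<Longrightarrow> a * c \<le> b * (c::'k::b_complete_semifield)"
  by (metis le_iff_add_eq distrib_right)

lemma mult_mono_idem: "a \<le> b \<Longrightarrow> c \<le> d \<Longrightarrow> a * c \<le> b * (d::'k::b_complete_semifield)"
  by (meson mult_left_mono_idem mult_right_mono_idem order.trans)

lemma power_mono_idem: "a \<le> b \<Longrightarrow> a ^ n \<le> (b::'k::b_complete_semifield) ^ n"
  by (induction n) (auto intro: mult_mono_idem)

lemma one_le_power_idem: "1 \<le> (a::'k::b_complete_semifield) \<Longrightarrow> 1 \<le> a ^ n"
  using power_mono_idem[of 1 a n] by simp

section \<open>Inverses of nonzero elements\<close>

definition uinv :: "'k::idempotent_semifield \<Rightarrow> 'k"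
  where "uinv x = (SOME y. x * y = 1 \<and> y * x = 1)"

lemma uinv:
  fixes x :: "'k::b_complete_semifield"
  assumes "x \<noteq> 0"
  shows "x * uinv x = 1" "uinv x * x = 1"
  using someI_ex[OF invertible[OF assms]] by (simp_all add: uinv_def)

lemma uinv_cancel:
  fixes x :: "'k::b_complete_semifield"
  assumes "x \<noteq> 0"
  shows "x * (uinv x * z) = z" "uinv x * (x * z) = z" "z * x * uinv x = z" "z * uinv x * x = z"
  by (simp_all add: uinv assms mult.assoc) (simp_all add: uinv assms flip: mult.assoc)

lemma uinv_unique: "x * y = 1 \<Longrightarrow> x \<noteq> 0 \<Longrightarrow> uinv x = (y::'k::b_complete_semifield)"
  by (metis uinv(2) mult.assoc mult_1_left mult_1_right)

lemma mult_nonzero: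
  fixes x y :: "'k::b_complete_semifield"
  assumes "x \<noteq> 0" "y \<noteq> 0" shows "x * y \<noteq> 0"
  by (metis assms mult_zero_right uinv_cancel(2))

lemma power_nonzero:
  fixes x :: "'k::b_complete_semifield"
  shows "x \<noteq> 0 \<Longrightarrow> x ^ n \<noteq> 0"
  by (induction n) (simp_all add: mult_nonzero)

lemma uinv_nonzero: "x \<noteq> 0 \<Longrightarrow> uinv (x::'k::b_complete_semifield) \<noteq> 0"
  by (metis uinv(1) mult_zero_right zero_neq_one)

lemma uinv_mult:
  fixes x y :: "'k::b_complete_semifield"
  assumes "x \<noteq> 0" "y \<noteq> 0" shows "uinv (x * y) = uinv y * uinv x"
proof (rule uinv_unique)
  have "x * y * (uinv y * uinv x) = x * (y * uinv y) * uinv x" by (simp only: mult.assoc)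
  then show "x * y * (uinv y * uinv x) = 1" by (simp add: uinv assms)
qed (simp add: mult_nonzero assms)

lemma uinv_power:
  fixes x :: "'k::b_complete_semifield"
  assumes "x \<noteq> 0" shows "uinv (x ^ n) = uinv x ^ n"
proof (induction n)
  case (Suc n)
  then show ?case by (metis uinv_mult assms power_Suc power_Suc2 power_nonzero)
qed (simp add: uinv_unique)

lemma uinv_left_le_iff:
  fixes x :: "'k::b_complete_semifield"
  assumes "x \<noteq> 0" shows "uinv x * a \<le> b \<longleftrightarrow> a \<le> x * b"
  by (metis assms mult_left_mono_idem uinv_cancel(1,2))

lemma uinv_right_le_iff:
  fixes x :: "'k::b_complete_semifield"
  assumes "x \<noteq> 0" shows "a * uinv x \<le> b \<longleftrightarrow> a \<le> b * x"
  by (metis assms mult_right_mono_idem uinv_cancel(3,4))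

lemma nonzero_if_one_le: "1 \<le> x \<Longrightarrow> (x::'k::b_complete_semifield) \<noteq> 0"
  by auto

text \<open>Multiplication by a nonzero \<open>c\<close> is an order automorphism with inverse
  multiplication by \<open>uinv c\<close>, so it preserves suprema.\<close>

lemma mult_Sup_left:
  fixes c :: "'k::b_complete_semifield"
  assumes "c \<noteq> 0" "X \<noteq> {}" "bdd_above X"
  shows "c * Sup X = (SUP x\<in>X. c * x)"
proof (rule order.antisym)
  have bdd: "bdd_above ((*) c ` X)"
    using assms(3) by (auto simp: bdd_above_def intro: mult_left_mono_idem)
  show "(SUP x\<in>X. c * x) \<le> c * Sup X"
    using assms by (auto intro!: cSUP_least mult_left_mono_idem cSup_upper)
  have "Sup X \<le> uinv c * (SUP x\<in>X. c * x)"
  proof (rule cSup_least[OF assms(2)])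
    fix x assume "x \<in> X"
    then have "c * x \<le> (SUP x\<in>X. c * x)" by (rule cSUP_upper[OF _ bdd])
    then have "uinv c * (c * x) \<le> uinv c * (SUP x\<in>X. c * x)" by (rule mult_left_mono_idem)
    then show "x \<le> uinv c * (SUP x\<in>X. c * x)" by (simp only: uinv_cancel[OF assms(1)])
  qed
  then show "c * Sup X \<le> (SUP x\<in>X. c * x)"
    by (metis assms(1) mult_left_mono_idem uinv_cancel(1))
qed

lemma mult_Sup_right:
  fixes c :: "'k::b_complete_semifield"
  assumes "c \<noteq> 0" "X \<noteq> {}" "bdd_above X"
  shows "Sup X * c = (SUP x\<in>X. x * c)"
proof (rule order.antisym)
  have bdd: "bdd_above ((\<lambda>x. x * c) ` X)"
    using assms(3) by (auto simp: bdd_above_def intro: mult_right_mono_idem)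
  show "(SUP x\<in>X. x * c) \<le> Sup X * c"
    using assms by (auto intro!: cSUP_least mult_right_mono_idem cSup_upper)
  have "Sup X \<le> (SUP x\<in>X. x * c) * uinv c"
  proof (rule cSup_least[OF assms(2)])
    fix x assume "x \<in> X"
    then have "x * c \<le> (SUP x\<in>X. x * c)" by (rule cSUP_upper[OF _ bdd])
    then have "x * c * uinv c \<le> (SUP x\<in>X. x * c) * uinv c" by (rule mult_right_mono_idem)
    then show "x \<le> (SUP x\<in>X. x * c) * uinv c" by (simp only: uinv_cancel[OF assms(1)])
  qed
  then show "Sup X * c \<le> (SUP x\<in>X. x * c)"
    by (metis assms(1) mult_right_mono_idem uinv_cancel(4))
qed

lemma mult_inf_left:
  fixes c :: "'k::b_complete_semifield"
  assumes "c \<noteq> 0"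
  shows "c * inf a b = inf (c * a) (c * b)"
proof (rule order.antisym)
  show "c * inf a b \<le> inf (c * a) (c * b)" by (simp add: mult_left_mono_idem)
  have "uinv c * inf (c * a) (c * b) \<le> inf a b" by (simp add: uinv_left_le_iff assms)
  then show "inf (c * a) (c * b) \<le> c * inf a b" by (simp only: uinv_left_le_iff[OF assms])
qed

text \<open>The supremum \<open>?s\<close> of all powers satisfies \<open>c * ?s \<le> ?s\<close>,
  and it cancels because \<open>1 \<le> ?s\<close>.\<close>

lemma power_bounded_imp_le_one:
  fixes c :: "'k::b_complete_semifield"
  assumes "\<And>n. c ^ n \<le> B"
  shows "c \<le> 1"
proof (cases "c = 0")
  case False
  let ?s = "SUP n. c ^ n"
  have bdd: "bdd_above (range ((^) c))" using assms by (auto simp: bdd_above_def)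
  have up: "c ^ n \<le> ?s" for n by (rule cSUP_upper[OF UNIV_I bdd])
  have s: "?s \<noteq> 0" using up[of 0] by (auto intro: nonzero_if_one_le)
  have "c * ?s = (SUP n. c * c ^ n)"
    using mult_Sup_left[OF False _ bdd] by (simp add: image_image)
  also have "\<dots> \<le> ?s"
    by (rule cSUP_least) (use up in \<open>auto simp flip: power_Suc\<close>)
  finally have "c * ?s * uinv ?s \<le> 1"
    using uinv_right_le_iff[OF s, of "c * ?s" 1] by simp
  then show ?thesis by (simp add: uinv_cancel s)
qed simp


section \<open>Commutativity of complete semifields\<close>

text \<open>Inversion reverses the order, so it turns joins, which are sums, into meets.\<close>

lemma inf_mult_add_uinv:
  fixes a b :: "'k::b_complete_semifield"
  assumes "a \<noteq> 0" "b \<noteq> 0"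
  shows "inf a b * (uinv a + uinv b) = 1" "inf a b \<noteq> 0"
proof -
  let ?s = "uinv a + uinv b"
  have s: "?s \<noteq> 0"
    by (metis add_eq_sup assms(1) eq_zero_if_le sup_ge1 uinv_nonzero)
  have "uinv ?s \<le> a" "uinv ?s \<le> b"
    by (metis add_eq_sup assms s sup_ge1 sup_ge2 uinv_left_le_iff uinv_right_le_iff
        mult_1_right mult_1_left uinv(1) mult_right_mono_idem)+
  then have 1: "uinv ?s \<le> inf a b" by simp
  then show i: "inf a b \<noteq> 0" using s uinv_nonzero by fastforce
  have "uinv a * inf a b \<le> 1" "uinv b * inf a b \<le> 1" by (simp_all add: uinv_left_le_iff assms)
  then have "?s * inf a b \<le> 1" unfolding distrib_right by (simp add: add_eq_sup)
  then have "inf a b \<le> uinv ?s"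
    by (metis s uinv_nonzero uinv_left_le_iff mult_1_right mult_left_mono_idem uinv_cancel(2))
  then show "inf a b * ?s = 1" using 1 s by (simp add: order.antisym uinv)
qed

text \<open>Orthogonality of positive elements in the lattice-ordered group of nonzero elements,
  written multiplicatively.\<close>

definition disjoint_above_one :: "'k::b_complete_semifield \<Rightarrow> 'k \<Rightarrow> bool"
  where "disjoint_above_one u v \<longleftrightarrow> 1 \<le> u \<and> 1 \<le> v \<and> inf u v = 1"

text \<open>These are the positive and negative parts of \<open>p\<close>. With \<open>q\<close> for
  the latter, \<open>p + 1 = p * q\<close> and \<open>inf p 1 = uinv q\<close>, so their meet is
  \<open>inf p 1 * q = 1\<close>.\<close>

lemma disjoint_pos_neg_parts:
  fixes p :: "'k::b_complete_semifield"
  assumes "p \<noteq> 0"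
  shows "disjoint_above_one (p + 1) (uinv p + 1)"
proof -
  let ?q = "uinv p + 1"
  have q: "?q \<noteq> 0" by (rule nonzero_if_one_le) (simp add: add_eq_sup)
  have 1: "inf p 1 * ?q = 1" using inf_mult_add_uinv(1)[OF assms, of 1] by (simp add: uinv_unique)
  then have "inf p 1 = uinv ?q" by (metis q uinv_cancel(3) mult_1_left)
  moreover have "inf (p + 1) ?q \<le> 1"
  proof -
    have "inf (p + 1) ?q * uinv ?q \<le> inf p 1"
    proof (rule inf_greatest)
      have "inf (p + 1) ?q \<le> p * ?q"
        using assms by (simp add: distrib_left uinv add.commute)
      then show "inf (p + 1) ?q * uinv ?q \<le> p" by (simp only: uinv_right_le_iff[OF q])
      show "inf (p + 1) ?q * uinv ?q \<le> 1"
        by (simp add: uinv_right_le_iff q)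
    qed
    then have "inf (p + 1) ?q \<le> inf p 1 * ?q" by (simp only: uinv_right_le_iff[OF q])
    then show ?thesis by (simp add: 1)
  qed
  ultimately show ?thesis
    by (simp add: disjoint_above_one_def add_eq_sup order.antisym)
qed

section \<open>Calculus of disjoint elements\<close>

lemma disjoint_mono:
  "disjoint_above_one u v \<Longrightarrow> 1 \<le> w \<Longrightarrow> w \<le> u \<Longrightarrow> disjoint_above_one w v"
  unfolding disjoint_above_one_def
  by (metis inf_greatest inf_mono order.antisym order.refl)

lemma disjoint_commute: "disjoint_above_one u v \<Longrightarrow> disjoint_above_one v u"
  by (simp add: disjoint_above_one_def inf.commute)

text \<open>From \<open>y \<le> u * y\<close> follows
  \<open>inf (u * v) y \<le> u * inf v y = u\<close>, so the meet is already below
  \<open>inf u y\<close>.\<close>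

lemma disjoint_mult:
  assumes "disjoint_above_one u y" "disjoint_above_one v y"
  shows "disjoint_above_one (u * v) y"
proof -
  have u: "1 \<le> u" "1 \<le> v" "1 \<le> y" "u \<noteq> 0"
    using assms by (auto simp: disjoint_above_one_def dest: nonzero_if_one_le)
  have "y \<le> u * y" using mult_right_mono_idem[OF u(1), of y] by simp
  then have "inf (u * v) y \<le> inf (u * v) (u * y)" by (meson inf_mono order.refl)
  also have "\<dots> = u" using assms(2) u by (simp add: disjoint_above_one_def flip: mult_inf_left)
  finally have "inf (u * v) y \<le> inf u y" by simp
  then have "inf (u * v) y \<le> 1" using assms(1) by (simp only: disjoint_above_one_def)
  moreover have "1 \<le> u * v" using mult_mono_idem[OF u(1,2)] by simp
  ultimately show ?thesis using u by (simp add: disjoint_above_one_def order.antisym)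
qed

lemma disjoint_power: "disjoint_above_one u y \<Longrightarrow> disjoint_above_one (u ^ n) y"
proof (induction n)
  case 0
  then show ?case by (simp add: disjoint_above_one_def inf.absorb1)
qed (simp add: disjoint_mult)

text \<open>The inverses have join \<open>1\<close>; expanding
  \<open>u * (uinv u + uinv v) * v\<close> shows that the product is the join, which is
  symmetric.\<close>

lemma disjoint_imp_mult_commute:
  assumes "disjoint_above_one u v"
  shows "u * v = v * u"
proof -
  have *: "b * c = b + c" if "disjoint_above_one b c" for b c :: 'a
  proof -
    have nz: "b \<noteq> 0" "c \<noteq> 0" and i: "inf b c = 1"
      using that by (auto simp: disjoint_above_one_def dest: nonzero_if_one_le)
    have "uinv b + uinv c = 1" using inf_mult_add_uinv(1)[OF nz] i by simp
    then have "b * c = b * (uinv b + uinv c) * c" by simp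
    also have "\<dots> = c + b" by (simp add: nz distrib_left distrib_right uinv uinv_cancel)
    finally show ?thesis by (simp add: add.commute)
  qed
  show ?thesis using *[OF assms] *[OF disjoint_commute[OF assms]] by (simp add: add.commute)
qed

text \<open>Completeness splits \<open>g\<close> into a part in the band generated by \<open>y\<close>, which commutes with \<open>u\<close>,
  and a part disjoint from \<open>y\<close>.\<close>

lemma disjoint_conjugate:
  assumes "disjoint_above_one u y" "1 \<le> g"
  shows "disjoint_above_one (uinv g * u * g) y"
proof -
  have u: "1 \<le> u" "1 \<le> y" "u \<noteq> 0" "y \<noteq> 0" "g \<noteq> 0"
    using assms by (auto simp: disjoint_above_one_def dest: nonzero_if_one_le)
  define X where "X = range (\<lambda>n. inf g (y ^ n))"
  define b where "b = Sup X"
  have bdd: "bdd_above X" by (auto simp: X_def bdd_above_def intro!: exI[of _ g])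
  have X: "X \<noteq> {}" "\<And>n. inf g (y ^ n) \<in> X" by (auto simp: X_def)
  have up: "inf g (y ^ n) \<le> b" for n unfolding b_def by (rule cSup_upper[OF X(2) bdd])
  have b1: "1 \<le> b" using up[of 0] assms(2) by (simp add: inf.absorb2)
  then have bnz: "b \<noteq> 0" by (rule nonzero_if_one_le)
  have bg: "b \<le> g" unfolding b_def using X by (auto simp: X_def intro!: cSup_least)
  define d where "d = uinv b * g"
  have g: "g = b * d" by (simp add: d_def uinv_cancel bnz)
  have "b * 1 \<le> g" using bg by simp
  then have d1: "1 \<le> d" unfolding d_def
    by (metis bnz mult_left_mono_idem uinv(2) mult_1_right)
  have dnz: "d \<noteq> 0" using d1 by (rule nonzero_if_one_le)
  \<comment> \<open>Multiplying \<open>inf g (y ^ n)\<close> by \<open>inf d y\<close> stays below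
    \<open>inf g (y ^ Suc n)\<close>, hence below \<open>b\<close>; taking suprema,
    \<open>b * inf d y \<le> b\<close>, and \<open>b\<close> cancels.\<close>
  have "inf d y \<le> 1"
  proof -
    have *: "z * inf d y \<le> b" if z: "z \<in> X" for z
    proof -
      obtain n where n: "z = inf g (y ^ n)" using z unfolding X_def by blast
      have "z * inf d y \<le> b * d" "z * inf d y \<le> y ^ n * y"
        using n up[of n] by (auto intro!: mult_mono_idem)
      then have "z * inf d y \<le> inf g (y ^ Suc n)" unfolding g by (metis inf_greatest power_Suc2)
      also have "\<dots> \<le> b" by (rule up)
      finally show ?thesis .
    qed
    have "b * inf d y = (SUP z\<in>X. z * inf d y)" unfolding b_def
      by (rule mult_Sup_right[OF inf_mult_add_uinv(2)[OF dnz u(4)] X(1) bdd])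
    also have "\<dots> \<le> b" by (rule cSUP_least[OF X(1)]) (rule *)
    finally have "uinv b * (b * inf d y) \<le> 1" by (simp add: uinv_left_le_iff bnz)
    then show ?thesis by (simp add: uinv_cancel bnz)
  qed
  then have dy: "disjoint_above_one d y"
    using d1 u by (simp add: disjoint_above_one_def order.antisym)
  \<comment> \<open>Below a power of \<open>y\<close>, \<open>z\<close> is disjoint from
    \<open>u\<close> and commutes with it. The supremum \<open>b\<close> inherits this, so
    conjugation of \<open>u\<close> by \<open>g\<close> reduces to conjugation by
    \<open>d\<close>.\<close>
  have comm: "u * z = z * u" if z: "z \<in> X" for z
  proof -
    obtain n where n: "z = inf g (y ^ n)" using z unfolding X_def by blast
    have "disjoint_above_one (y ^ n) u"
      using assms(1) disjoint_commute disjoint_power by blast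
    then have "disjoint_above_one z u"
      by (rule disjoint_mono) (use n one_le_power_idem[OF u(2)] assms(2) in auto)
    then show ?thesis by (metis disjoint_imp_mult_commute)
  qed
  have "u * b = b * u" unfolding b_def
    using mult_Sup_left[OF u(3) X(1) bdd] mult_Sup_right[OF u(3) X(1) bdd] comm by simp
  then have "uinv b * u * b = u" by (simp add: mult.assoc uinv_cancel bnz)
  then have "uinv g * u * g = uinv d * u * d"
    by (simp add: g uinv_mult bnz dnz mult.assoc) (metis mult.assoc)
  moreover have "1 \<le> uinv d * u * d"
    using mult_left_mono_idem[OF mult_right_mono_idem[OF u(1), of d], of "uinv d"]
    by (simp add: uinv dnz mult.assoc)
  \<comment> \<open>Since \<open>d\<close> commutes with \<open>y\<close>, conjugating the meet back
    by \<open>d\<close> puts it below both \<open>u\<close> and \<open>y\<close>.\<close>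
  moreover have "inf (uinv d * u * d) y \<le> 1" (is "?w \<le> 1")
  proof -
    have yd: "d * y = y * d" by (rule disjoint_imp_mult_commute[OF dy])
    have "d * ?w \<le> d * (uinv d * u * d)" "d * ?w \<le> d * y"
      by (auto intro!: mult_left_mono_idem)
    then have "d * ?w \<le> u * d" "d * ?w \<le> y * d"
      by (simp_all add: mult.assoc uinv_cancel dnz yd)
    then have "d * ?w * uinv d \<le> inf u y"
      by (simp add: uinv_right_le_iff dnz)
    then have "d * ?w * uinv d \<le> 1" using assms(1) by (simp only: disjoint_above_one_def)
    then have "d * ?w \<le> d" by (simp add: uinv_right_le_iff dnz)
    then show ?thesis using uinv_left_le_iff[OF dnz, of "d * ?w" 1] by (simp add: uinv_cancel dnz)
  qed
  ultimately show ?thesis using u by (simp add: disjoint_above_one_def order.antisym)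
qed

text \<open>\<open>x\<close> and its conjugate \<open>f\<close> are compared with the levels
  \<open>e ^ m\<close>: where \<open>f\<close> exceeds \<open>x * e\<close>, it would have to exceed
  one level after another, yet \<open>f \<le> a = e ^ n\<close>. The excess is measured by
  \<open>y\<close>.\<close>

lemma mult_le_mult_swap:
  fixes x a e :: "'k::b_complete_semifield"
  assumes "1 \<le> x" "x \<le> a" "e ^ n = a" "e \<noteq> 0" "n \<noteq> 0"
  shows "uinv a * x * a \<le> x * e"
proof -
  have a1: "1 \<le> a" using assms by order
  have nz: "a \<noteq> 0" "x \<noteq> 0" using a1 assms(1) by (auto dest: nonzero_if_one_le)
  define f where "f = uinv a * x * a"
  have fnz: "f \<noteq> 0" by (simp add: f_def nz mult_nonzero uinv_nonzero)
  define U where "U m = f * uinv e ^ m + 1" for m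
  define V where "V m = e ^ m * uinv x + 1" for m
  have one: "1 \<le> U m" "1 \<le> V m" for m by (simp_all add: U_def V_def add_eq_sup)
  \<comment> \<open>\<open>?p + 1\<close> and \<open>V m\<close> are the positive and negative parts
    of \<open>?p\<close>. Conjugation by \<open>a\<close> turns the former into \<open>U m\<close>,
    because \<open>a\<close> is a power of \<open>e\<close> and commutes with
    \<open>e ^ m\<close>.\<close>
  have disj: "disjoint_above_one (U m) (V m)" for m
  proof -
    let ?p = "x * uinv e ^ m"
    have em: "e ^ m \<noteq> 0" by (simp add: power_nonzero assms)
    have p: "?p \<noteq> 0" by (simp add: mult_nonzero power_nonzero uinv_nonzero nz assms)
    have "uinv ?p = e ^ m * uinv x"
      by (rule uinv_unique[OF _ p])
        (simp add: uinv nz uinv_cancel em assms mult.assoc flip: uinv_power)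
    then have "disjoint_above_one (uinv a * (?p + 1) * a) (V m)"
      using disjoint_conjugate[OF disjoint_pos_neg_parts[OF p] a1] by (simp add: V_def)
    moreover have "uinv a * (?p + 1) * a = U m"
    proof -
      have "e ^ m * a = a * e ^ m" by (simp add: add.commute flip: assms(3) power_add)
      then have "uinv (e ^ m) * a = a * uinv (e ^ m)"
        by (metis em uinv_cancel(2,3) mult.assoc)
      then show ?thesis unfolding U_def f_def
        by (simp add: distrib_left distrib_right uinv nz mult.assoc assms flip: uinv_power)
    qed
    ultimately show ?thesis by simp
  qed
  define y where "y = f * uinv e * uinv x + 1"
  have y1: "1 \<le> y" by (simp add: y_def add_eq_sup)
  have yUV: "y \<le> U (Suc m) * V m" for m
  proof -
    have "f * uinv e ^ Suc m * (e ^ m * uinv x) \<le> U (Suc m) * V m"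
      unfolding U_def V_def by (rule mult_mono_idem) (simp_all add: add_eq_sup)
    moreover have "f * uinv e ^ Suc m * (e ^ m * uinv x) = f * uinv e * uinv x"
      by (simp add: mult.assoc uinv_cancel assms power_nonzero flip: uinv_power)
    moreover have "1 \<le> U (Suc m) * V m" using mult_mono_idem[OF one] by fastforce
    ultimately show ?thesis by (simp add: y_def add_eq_sup)
  qed
  \<comment> \<open>Once \<open>y \<le> U (Suc m)\<close>, \<open>y\<close> is disjoint from
    \<open>V (Suc m)\<close>, so this factor can be removed from the bound \<open>yUV\<close>. The
    induction starts with \<open>V 0 = 1\<close>, by \<open>1 \<le> x\<close>.\<close>
  have "y \<le> U (Suc m)" for m
  proof (induction m)
    case 0
    have "uinv x \<le> 1" using uinv_left_le_iff[OF nz(2), of 1 1] assms(1) by simp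
    then have "V 0 = 1" by (simp add: V_def add_eq_sup sup.absorb2)
    then show ?case using yUV[of 0] by simp
  next
    case (Suc m)
    have i: "inf y (V (Suc m)) = 1"
      using disjoint_mono[OF disj y1 Suc] by (simp add: disjoint_above_one_def)
    have "y \<le> U (Suc (Suc m)) * y"
      using mult_right_mono_idem[OF one(1), of y] by simp
    then have "y \<le> inf (U (Suc (Suc m)) * y) (U (Suc (Suc m)) * V (Suc m))"
      using yUV by simp
    also have "\<dots> = U (Suc (Suc m))"
      using one(1) by (simp add: i nonzero_if_one_le flip: mult_inf_left)
    finally show ?case .
  qed
  moreover have "U n = 1"
  proof -
    have "f \<le> a" unfolding f_def mult.assoc uinv_left_le_iff[OF nz(1)]
      by (rule mult_right_mono_idem) (rule assms)
    then have "f * uinv a \<le> 1" by (simp add: uinv_right_le_iff nz)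
    then show ?thesis
      using assms by (simp add: U_def add_eq_sup sup.absorb2 flip: uinv_power)
  qed
  ultimately have "y \<le> 1" by (metis assms(5) not0_implies_Suc)
  then have "f * uinv e * uinv x \<le> 1" by (simp add: y_def add_eq_sup)
  then have "f \<le> x * e" by (simp add: uinv_right_le_iff nz assms)
  then show ?thesis by (simp add: f_def)
qed

text \<open>Every \<open>n\<close>-th root of \<open>a\<close> with \<open>n \<noteq> 0\<close>
  bounds the commutator \<open>?c\<close>, so all powers of \<open>?c\<close> stay below
  \<open>a\<close>, which forces \<open>?c \<le> 1\<close>.\<close>

lemma mult_le_swap:
  fixes x a :: "'k::{b_complete_semifield, algebraically_closed_semiring}"
  assumes "1 \<le> x" "x \<le> a"
  shows "x * a \<le> a * x"
proof -
  have nz: "a \<noteq> 0" "x \<noteq> 0" using assms by (auto dest: nonzero_if_one_le)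
  let ?c = "uinv x * (uinv a * x * a)"
  have "?c ^ n \<le> a" for n
  proof (cases "n = 0")
    case True
    then show ?thesis using assms by auto
  next
    case False
    then obtain e where e: "e ^ n = a" using root_exists[of n a] by auto
    then have "e \<noteq> 0" using False nz by (auto simp: power_0_left)
    then have "?c \<le> e"
      using mult_le_mult_swap[OF assms e _ False] by (simp add: uinv_left_le_iff nz)
    then show ?thesis using e power_mono_idem by blast
  qed
  then have "?c \<le> 1" by (rule power_bounded_imp_le_one)
  then show ?thesis by (simp add: uinv_left_le_iff nz mult.assoc)
qed

lemma mult_commute_if_le:
  fixes x a :: "'k::{b_complete_semifield, algebraically_closed_semiring}"
  assumes "1 \<le> x" "x \<le> a"
  shows "x * a = a * x"
proof (rule order.antisym)
  show "x * a \<le> a * x" by (rule mult_le_swap[OF assms])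
  have nz: "a \<noteq> 0" "x \<noteq> 0" using assms by (auto dest: nonzero_if_one_le)
  \<comment> \<open>For the reverse inequality, \<open>uinv x * a\<close> also lies between
    \<open>1\<close> and \<open>a\<close>, and inverting \<open>x\<close> flips the
    estimate.\<close>
  have "1 \<le> uinv x * a"
    using mult_left_mono_idem[OF assms(2), of "uinv x"] by (simp add: uinv nz)
  moreover have "uinv x * a \<le> a"
    using mult_right_mono_idem[OF assms(1), of a] by (simp add: uinv_left_le_iff nz)
  ultimately have "uinv x * a * a \<le> a * (uinv x * a)" by (rule mult_le_swap)
  then have "uinv x * a * a * uinv a \<le> a * (uinv x * a) * uinv a"
    by (rule mult_right_mono_idem)
  then have "uinv x * a \<le> a * uinv x"
    by (simp add: mult.assoc uinv nz)
  then have "a \<le> x * (a * uinv x)" by (simp only: uinv_left_le_iff[OF nz(2)])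
  then have "a * x \<le> x * (a * uinv x) * x" by (rule mult_right_mono_idem)
  then show "a * x \<le> x * a" by (simp add: mult.assoc uinv nz)
qed

text \<open>Iwasawa's theorem for conditionally complete lattice-ordered groups; roots are used only to
  shorten the proof.\<close>

lemma semifield_mult_commute:
  fixes a b :: "'k::{b_complete_semifield, algebraically_closed_semiring}"
  shows "a * b = b * a"
proof -
  have pos: "a * b = b * a" if "1 \<le> a" "1 \<le> b" for a b :: 'k
  proof -
    have nz: "a \<noteq> 0" using that by (auto dest: nonzero_if_one_le)
    \<comment> \<open>\<open>a\<close> and \<open>b\<close> need not be comparable, but
      \<open>a\<close> and \<open>a * b\<close> are; they commute, and \<open>a\<close>
      cancels.\<close>
    have "a \<le> a * b" using mult_left_mono_idem[OF that(2), of a] by simp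
    then have "a * (a * b) = a * b * a" by (rule mult_commute_if_le[OF that(1)])
    then show ?thesis by (metis mult.assoc nz uinv_cancel(2))
  qed
  have inv: "a * uinv b = uinv b * a" if "a * b = b * a" "b \<noteq> 0" for a b :: 'k
    using that by (metis mult.assoc uinv_cancel(2,3))
  have decomp: "\<exists>p q. 1 \<le> p \<and> 1 \<le> q \<and> a = p * uinv q" if "a \<noteq> 0" for a :: 'k
  proof (intro exI conjI)
    show "1 \<le> a + 1" "1 \<le> uinv a + 1" by (simp_all add: add_eq_sup)
    then have nz: "uinv a + 1 \<noteq> 0" by (auto dest: nonzero_if_one_le)
    have "a + 1 = a * (uinv a + 1)" by (simp add: distrib_left uinv that add.commute)
    then show "a = (a + 1) * uinv (uinv a + 1)" by (simp add: uinv_cancel nz)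
  qed
  show ?thesis
  proof (cases "a = 0 \<or> b = 0")
    case False
    obtain p q where a: "1 \<le> p" "1 \<le> q" "a = p * uinv q" using decomp False by blast
    obtain r s where b: "1 \<le> r" "1 \<le> s" "b = r * uinv s" using decomp False by blast
    have nz: "q \<noteq> 0" "s \<noteq> 0" using a b by (auto dest: nonzero_if_one_le)
    have c: "p * r = r * p" "p * uinv s = uinv s * p" "r * uinv q = uinv q * r"
      "uinv q * uinv s = uinv s * uinv q"
      using a b nz pos inv by metis+
    have "a * b = p * (uinv q * r) * uinv s" by (simp only: a b mult.assoc)
    also have "\<dots> = p * r * (uinv q * uinv s)" by (simp only: c(3)[symmetric] mult.assoc)
    also have "\<dots> = r * (p * uinv s) * uinv q" by (simp only: c(1,4)) (simp only: mult.assoc)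
    also have "\<dots> = b * a" by (simp only: c(2) a b mult.assoc)
    finally show ?thesis .
  qed auto
qed


section \<open>Archimedean spaces\<close>

context idempotent_b_space
begin

lemma scale_mono_left: "a \<le> b \<Longrightarrow> scale a y \<le> scale b y"
  by (metis le_iff_add_eq scale_left_distrib)

lemma scale_mono_right: "y \<le> z \<Longrightarrow> scale a y \<le> scale a z"
  by (metis le_iff_add_eq scale_right_distrib)

lemma scale_uinv: "k \<noteq> 0 \<Longrightarrow> scale (uinv k) (scale k y) = y" "k \<noteq> 0 \<Longrightarrow> scale k (scale (uinv k) y) = y"
  by (simp_all add: scale_scale uinv scale_one)

lemma scale_uinv_le_iff: "k \<noteq> 0 \<Longrightarrow> scale (uinv k) y \<le> z \<longleftrightarrow> y \<le> scale k z"
  by (metis scale_mono_right scale_uinv)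

text \<open>\<open>Inf_scale\<close> covers only sets bounded above, so \<open>S\<close> is first
  cut off at one of its members \<open>k0\<close>.\<close>

lemma le_scale_Inf:
  assumes "S \<noteq> {}" and le: "\<And>k. k \<in> S \<Longrightarrow> z \<le> scale k y"
  shows "z \<le> scale (Inf S) y"
proof -
  obtain k0 where k0: "k0 \<in> S" using assms(1) by blast
  let ?T = "(\<lambda>k. inf k k0) ` S"
  have T: "?T \<noteq> {}" "bdd_above ?T" using k0 by (auto intro!: bdd_aboveI[of _ k0])
  have "z \<le> scale (inf k k0) y" if "k \<in> S" for k
  proof -
    have "inf k k0 = Inf {k, k0}" by (simp add: cInf_insert)
    also have "scale \<dots> y = Inf ((\<lambda>q. scale q y) ` {k, k0})" by (rule Inf_scale) auto
    also have "z \<le> \<dots>" by (rule cInf_greatest) (use le that k0 in auto)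
    finally show ?thesis .
  qed
  then have "z \<le> scale (Inf ?T) y"
    unfolding Inf_scale[OF T] by (auto intro!: cInf_greatest simp: assms)
  also have "Inf ?T \<le> Inf S"
    by (rule cInf_greatest[OF assms(1)]) (auto intro: cInf_lower2)
  then have "scale (Inf ?T) y \<le> scale (Inf S) y" by (rule scale_mono_left)
  finally show ?thesis .
qed

text \<open>The defining infimum is attained, which makes \<open>star e\<close> the lower adjoint of
  \<open>\<lambda>k. scale k e\<close>.\<close>

lemma star_le_iff:
  assumes "archimedean_element e"
  shows "star e y \<le> k \<longleftrightarrow> y \<le> scale k e"
proof
  assume "star e y \<le> k"
  have "y \<le> scale (star e y) e" unfolding star_def
    by (rule le_scale_Inf) (use assms in \<open>auto simp: archimedean_element_def\<close>)
  also have "\<dots> \<le> scale k e" by (rule scale_mono_left) fact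
  finally show "y \<le> scale k e" .
next
  assume "y \<le> scale k e"
  then show "star e y \<le> k" unfolding star_def by (intro cInf_lower) auto
qed

lemma star_scale:
  assumes "archimedean_element e" "k \<noteq> 0"
  shows "star e (scale k y) = k * star e y"
proof -
  have "star e (scale k y) \<le> m \<longleftrightarrow> k * star e y \<le> m" for m
  proof -
    have k: "uinv k \<noteq> 0" "uinv (uinv k) = k"
      using assms(2) uinv_unique[of "uinv k" k] by (simp_all add: uinv_nonzero uinv)
    have "star e (scale k y) \<le> m \<longleftrightarrow> y \<le> scale (uinv k) (scale m e)"
      using scale_uinv_le_iff[OF k(1), of y "scale m e"] by (simp add: star_le_iff assms k)
    also have "\<dots> \<longleftrightarrow> star e y \<le> uinv k * m" by (simp add: star_le_iff assms scale_scale)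
    also have "\<dots> \<longleftrightarrow> k * star e y \<le> m"
      using uinv_left_le_iff[OF k(1), of "star e y" m] by (simp add: k)
    finally show ?thesis .
  qed
  then show ?thesis by (meson order.antisym order.refl)
qed

end


section \<open>Closed invariant subspaces\<close>

locale archimedean_representation = idempotent_b_space scale
  for scale :: "'k::{b_complete_semifield, algebraically_closed_semiring} \<Rightarrow>
      'v::b_complete_semigroup \<Rightarrow> 'v" +
  fixes G :: "('g, 'm) monoid_scheme" (structure)
    and \<pi> :: "'g \<Rightarrow> 'v \<Rightarrow> 'v"
    and e :: 'v
  assumes group: "group G"
    and rep: "linear_representation G scale \<pi>"
    and e: "wo_continuous_archimedean_element e"
    and nontrivial: "\<exists>v::'v. v \<noteq> 0"
begin

sublocale group G by (rule group)

section \<open>The gauge of a vector\<close>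

lemma arch: "archimedean_element e"
  using e by (simp add: wo_continuous_archimedean_element_def)

abbreviation gauge :: "'v \<Rightarrow> 'k"
  where "gauge \<equiv> star e"

lemmas gauge_le_iff = star_le_iff[OF arch]
  and gauge_scale = star_scale[OF arch]

lemma le_gauge: "y \<le> scale (gauge y) e"
  by (simp flip: gauge_le_iff)

lemma gauge_mono: "y \<le> z \<Longrightarrow> gauge y \<le> gauge z"
  using le_gauge[of z] by (auto simp: gauge_le_iff)

lemma gauge_eq_zero_iff: "gauge y = 0 \<longleftrightarrow> y = 0"
  using gauge_le_iff[of y 0] by (simp add: scale_zero_left)

lemma gauge_Inf_chain:
  assumes "X \<noteq> {}" "bdd_above X" "Complete_Partial_Order.chain (\<le>) X"
  shows "gauge (Inf X) = Inf (gauge ` X)"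
  using e assms by (simp add: wo_continuous_archimedean_element_def wo_continuous_def)

section \<open>The action of the group\<close>

lemma rep_Units: "g \<in> carrier G \<Longrightarrow> \<pi> g \<in> Units (End scale)"
  using rep by (auto simp: linear_representation_def hom_def units_of_def)

lemma rep_b_linear:
  assumes "g \<in> carrier G" shows "b_linear scale scale (\<pi> g)"
  using rep_Units[OF assms] by (simp add: Units_def End_def)

lemma rep_mult: "g \<in> carrier G \<Longrightarrow> h \<in> carrier G \<Longrightarrow> \<pi> (g \<otimes> h) y = \<pi> g (\<pi> h y)"
  using rep by (auto simp: linear_representation_def hom_def units_of_def End_def)

lemma rep_one: "\<pi> \<one> y = y"
proof -
  obtain f where "f \<circ> \<pi> \<one> = id"
    using rep_Units[OF one_closed] by (auto simp: Units_def End_def)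
  then have "f (\<pi> \<one> z) = z" for z by (metis comp_apply id_apply)
  then show ?thesis using rep_mult[OF one_closed one_closed, of y] by (metis l_one one_closed)
qed

lemma rep_inv:
  assumes "g \<in> carrier G"
  shows "\<pi> (inv g) (\<pi> g y) = y" "\<pi> g (\<pi> (inv g) y) = y"
  using assms by (simp_all add: rep_one flip: rep_mult)

lemma rep_scale: "g \<in> carrier G \<Longrightarrow> \<pi> g (scale k y) = scale k (\<pi> g y)"
  using rep_b_linear by (simp add: b_linear_def)

lemma rep_Sup: "g \<in> carrier G \<Longrightarrow> bdd_above X \<Longrightarrow> \<pi> g (Sup X) = Sup (\<pi> g ` X)"
  using rep_b_linear by (simp add: b_linear_def)

lemma rep_mono: "g \<in> carrier G \<Longrightarrow> y \<le> z \<Longrightarrow> \<pi> g y \<le> \<pi> g z"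
  using rep_b_linear unfolding b_linear_def le_iff_add_eq by metis

lemma rep_zero: "g \<in> carrier G \<Longrightarrow> \<pi> g 0 = 0"
  by (metis rep_scale scale_zero_left)

lemma rep_eq_zero_iff: "g \<in> carrier G \<Longrightarrow> \<pi> g y = 0 \<longleftrightarrow> y = 0"
  by (metis inv_closed rep_inv(1) rep_zero)

text \<open>\<open>gauge (\<pi> g e)\<close> serves as an operator norm of \<open>\<pi> g\<close>,
  since \<open>y\<close> lies below \<open>scale (gauge y) e\<close>.\<close>

lemma gauge_rep_le:
  assumes "g \<in> carrier G"
  shows "gauge (\<pi> g y) \<le> gauge y * gauge (\<pi> g e)"
proof -
  have "\<pi> g y \<le> \<pi> g (scale (gauge y) e)" by (rule rep_mono[OF assms le_gauge])
  also have "\<dots> = scale (gauge y) (\<pi> g e)" by (rule rep_scale[OF assms])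
  also have "\<dots> \<le> scale (gauge y) (scale (gauge (\<pi> g e)) e)"
    by (rule scale_mono_right) (rule le_gauge)
  finally show ?thesis by (simp add: gauge_le_iff scale_scale)
qed

text \<open>The first clause includes sums and \<open>0\<close>, as suprema of two-element sets and
  of the empty set. Closure under infima keeps limits of decreasing sequences in
  \<open>W\<close>.\<close>

definition invariant_subspace :: "'v set \<Rightarrow> bool"
  where "invariant_subspace W \<longleftrightarrow>
    (\<forall>X\<subseteq>W. bdd_above X \<longrightarrow> Sup X \<in> W) \<and> (\<forall>X\<subseteq>W. X \<noteq> {} \<longrightarrow> Inf X \<in> W) \<and>
    (\<forall>k. \<forall>y\<in>W. scale k y \<in> W) \<and> (\<forall>g\<in>carrier G. \<forall>y\<in>W. \<pi> g y \<in> W) \<and> (\<exists>y\<in>W. y \<noteq> 0)"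

text \<open>For an invariant subspace \<open>W\<close> this is the greatest vector of gauge at most
  \<open>1\<close>; inside \<open>W\<close> it takes over the role of \<open>e\<close>.\<close>

definition unit_ball_top :: "'v set \<Rightarrow> 'v"
  where "unit_ball_top W = Sup {y \<in> W. gauge y \<le> 1}"

lemma bdd_above_unit_ball: "bdd_above {y \<in> W. gauge y \<le> 1}"
  by (auto simp: bdd_above_def gauge_le_iff scale_one)

lemma unit_ball_top_mono:
  assumes "U \<subseteq> W" "0 \<in> U"
  shows "unit_ball_top U \<le> unit_ball_top W"
  unfolding unit_ball_top_def
proof (rule cSup_subset_mono[OF _ bdd_above_unit_ball])
  show "{y \<in> U. gauge y \<le> 1} \<noteq> {}"
    using assms gauge_eq_zero_iff[of 0] by fastforce
qed (use assms in auto)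

lemma invariant_subspace_zero: "invariant_subspace W \<Longrightarrow> 0 \<in> W"
  unfolding invariant_subspace_def by (metis scale_zero_left)

lemma le_scale_unit_ball_top:
  assumes "invariant_subspace W" "y \<in> W"
  shows "y \<le> scale (gauge y) (unit_ball_top W)"
proof (cases "y = 0")
  case False
  then have s: "gauge y \<noteq> 0" by (simp add: gauge_eq_zero_iff)
  have "scale (uinv (gauge y)) y \<in> W" using assms by (simp add: invariant_subspace_def)
  moreover have "gauge (scale (uinv (gauge y)) y) = 1"
    by (simp add: gauge_scale uinv_nonzero uinv s)
  ultimately have "scale (uinv (gauge y)) y \<le> unit_ball_top W"
    unfolding unit_ball_top_def by (intro cSup_upper[OF _ bdd_above_unit_ball]) auto
  then show ?thesis by (simp add: scale_uinv_le_iff s)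
qed simp

lemma unit_ball_top_in: "invariant_subspace W \<Longrightarrow> unit_ball_top W \<in> W"
  using bdd_above_unit_ball[of W] by (simp add: invariant_subspace_def unit_ball_top_def)

text \<open>All competitors lie below \<open>e\<close>, which bounds the gauge by \<open>1\<close>.
  Conversely, a nonzero \<open>y\<close> in \<open>W\<close> lies below the top scaled by
  \<open>gauge y\<close>; taking gauges, \<open>gauge y\<close> cancels.\<close>

lemma gauge_unit_ball_top:
  assumes "invariant_subspace W" shows "gauge (unit_ball_top W) = 1"
proof (rule order.antisym)
  have "unit_ball_top W \<le> e" unfolding unit_ball_top_def
  proof (rule cSup_least)
    show "{y \<in> W. gauge y \<le> 1} \<noteq> {}"
      using invariant_subspace_zero[OF assms] gauge_eq_zero_iff[of 0] by fastforce
  qed (auto simp: gauge_le_iff scale_one)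
  then show "gauge (unit_ball_top W) \<le> 1" by (simp add: gauge_le_iff scale_one)
  obtain y where y: "y \<in> W" "y \<noteq> 0" using assms by (auto simp: invariant_subspace_def)
  then have s: "gauge y \<noteq> 0" by (simp add: gauge_eq_zero_iff)
  have "gauge y \<le> gauge y * gauge (unit_ball_top W)"
    using gauge_mono[OF le_scale_unit_ball_top[OF assms y(1)]] by (simp add: gauge_scale s)
  then have "uinv (gauge y) * gauge y \<le> gauge (unit_ball_top W)" by (simp only: uinv_left_le_iff[OF s])
  then show "1 \<le> gauge (unit_ball_top W)" by (simp add: uinv s)
qed

lemma unit_ball_top_nonzero: "invariant_subspace W \<Longrightarrow> unit_ball_top W \<noteq> 0"
  by (metis gauge_eq_zero_iff gauge_unit_ball_top zero_neq_one)

text \<open>The delicate point is a nonzero vector. The tops form a chain of vectors of gauge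
  \<open>1\<close>, and \<open>wo\<close>-continuity passes this gauge on to their infimum
  \<open>?b\<close>.\<close>

lemma invariant_subspace_Inter:
  assumes chain: "\<And>U W. U \<in> C \<Longrightarrow> W \<in> C \<Longrightarrow> U \<subseteq> W \<or> W \<subseteq> U"
    and C: "\<And>W. W \<in> C \<Longrightarrow> invariant_subspace W" "C \<noteq> {}"
  shows "invariant_subspace (\<Inter>C)"
proof -
  let ?b = "Inf (unit_ball_top ` C)"
  have le_e: "unit_ball_top W \<le> e" if "W \<in> C" for W
    using gauge_unit_ball_top[OF C(1)[OF that]] gauge_le_iff[of "unit_ball_top W" 1] by (simp add: scale_one)
  have mono: "U \<subseteq> W \<Longrightarrow> unit_ball_top U \<le> unit_ball_top W" if "U \<in> C" for U W
    using that C(1) invariant_subspace_zero unit_ball_top_mono by blast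
  have "gauge ?b = Inf (gauge ` unit_ball_top ` C)"
  proof (rule gauge_Inf_chain)
    show "bdd_above (unit_ball_top ` C)" using le_e by (auto simp: bdd_above_def)
    show "Complete_Partial_Order.chain (\<le>) (unit_ball_top ` C)"
      unfolding Complete_Partial_Order.chain_def
    proof (intro ballI)
      fix y z assume "y \<in> unit_ball_top ` C" "z \<in> unit_ball_top ` C"
      then obtain U W where "U \<in> C" "W \<in> C" "y = unit_ball_top U" "z = unit_ball_top W" by blast
      then show "y \<le> z \<or> z \<le> y" using chain[of U W] mono by blast
    qed
    show "unit_ball_top ` C \<noteq> {}" using C(2) by blast
  qed
  also have "gauge ` unit_ball_top ` C = {1}"
    using C gauge_unit_ball_top by (force simp: image_image)
  finally have "?b \<noteq> 0" by (auto simp flip: gauge_eq_zero_iff)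
  moreover have "?b \<in> W" if "W \<in> C" for W
  proof -
    let ?D = "{U \<in> C. U \<subseteq> W}"
    have "?b = Inf (unit_ball_top ` ?D)"
    proof (rule order.antisym)
      show "?b \<le> Inf (unit_ball_top ` ?D)"
        by (rule cInf_superset_mono) (use that in auto)
      show "Inf (unit_ball_top ` ?D) \<le> ?b"
      proof (rule cINF_greatest[OF C(2)])
        fix U assume U: "U \<in> C"
        show "Inf (unit_ball_top ` ?D) \<le> unit_ball_top U"
        proof (cases "U \<subseteq> W")
          case True
          then show ?thesis using U by (intro cINF_lower) auto
        next
          case False
          then have "W \<subseteq> U" using chain U that by blast
          then show ?thesis using that mono by (intro cINF_lower2[of _ _ W]) auto
        qed
      qed
    qed
    moreover have "unit_ball_top ` ?D \<subseteq> W" using C(1) unit_ball_top_in by blast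
    moreover have "unit_ball_top ` ?D \<noteq> {}" using that by blast
    ultimately show ?thesis using C(1)[OF that] by (simp add: invariant_subspace_def)
  qed
  ultimately have "\<exists>y\<in>\<Inter>C. y \<noteq> 0" by blast
  moreover have "Sup X \<in> W" if "W \<in> C" "X \<subseteq> \<Inter>C" "bdd_above X" for X W
  proof -
    have "X \<subseteq> W" using that by blast
    then show ?thesis using C(1)[OF that(1)] that(3) by (simp add: invariant_subspace_def)
  qed
  moreover have "Inf X \<in> W" if "W \<in> C" "X \<subseteq> \<Inter>C" "X \<noteq> {}" for X W
  proof -
    have "X \<subseteq> W" using that by blast
    then show ?thesis using C(1)[OF that(1)] that(3) by (simp add: invariant_subspace_def)
  qed
  moreover have "scale k y \<in> W" "g \<in> carrier G \<Longrightarrow> \<pi> g y \<in> W" if "W \<in> C" "y \<in> \<Inter>C" for k g y W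
    using C(1)[OF that(1)] that by (auto simp: invariant_subspace_def)
  ultimately show ?thesis by (simp add: invariant_subspace_def)
qed

section \<open>Minimal invariant subspaces\<close>

definition irreducible_subspace :: "'v set \<Rightarrow> bool"
  where "irreducible_subspace W \<longleftrightarrow>
    invariant_subspace W \<and> (\<forall>U. invariant_subspace U \<longrightarrow> U \<subseteq> W \<longrightarrow> U = W)"

lemma ex_irreducible_subspace: "\<exists>W. irreducible_subspace W"
proof -
  let ?A = "Collect invariant_subspace"
  have UNIV: "invariant_subspace UNIV" using nontrivial by (auto simp: invariant_subspace_def)
  have "\<exists>W\<in>?A. \<forall>U\<in>?A. W \<supseteq> U \<longrightarrow> U = W"
  proof (rule predicate_Zorn)
    show "partial_order_on ?A (relation_of (\<supseteq>) ?A)"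
      by (rule partial_order_on_relation_ofI) auto
    fix C assume C: "C \<in> Chains (relation_of (\<supseteq>) ?A)"
    then have inv: "invariant_subspace W" if "W \<in> C" for W
      using that by (auto simp: Chains_def relation_of_def)
    have chain: "U \<subseteq> W \<or> W \<subseteq> U" if "U \<in> C" "W \<in> C" for U W
      using C that by (auto simp: Chains_def relation_of_def)
    show "\<exists>U\<in>?A. \<forall>W\<in>C. W \<supseteq> U"
    proof (cases "C = {}")
      case True
      then show ?thesis using UNIV by auto
    next
      case False
      then have "invariant_subspace (\<Inter>C)" using invariant_subspace_Inter chain inv by metis
      then show ?thesis by blast
    qed
  qed
  then show ?thesis unfolding irreducible_subspace_def by blast
qed


section \<open>Operators on an irreducible subspace\<close>

definition centralizing :: "'v set \<Rightarrow> 'g \<Rightarrow> bool"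
  where "centralizing W h \<longleftrightarrow> h \<in> carrier G \<and> (\<forall>g\<in>carrier G. \<forall>y\<in>W. \<pi> g (\<pi> h y) = \<pi> h (\<pi> g y))"

lemma centralizing_inv:
  assumes "invariant_subspace W" "centralizing W h"
  shows "centralizing W (inv h)"
proof -
  have h: "h \<in> carrier G" using assms by (simp add: centralizing_def)
  have "\<pi> g (\<pi> (inv h) y) = \<pi> (inv h) (\<pi> g y)" if "g \<in> carrier G" "y \<in> W" for g y
  proof -
    have "\<pi> (inv h) y \<in> W" using assms that h by (simp add: invariant_subspace_def)
    then have "\<pi> (inv h) (\<pi> g (\<pi> h (\<pi> (inv h) y))) = \<pi> (inv h) (\<pi> h (\<pi> g (\<pi> (inv h) y)))"
      using assms(2) that by (simp add: centralizing_def)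
    then show ?thesis by (simp add: rep_inv h)
  qed
  then show ?thesis using h by (simp add: centralizing_def)
qed

text \<open>The vectors satisfying the inequality form an invariant subspace, so irreducibility turns
  one of them into all of them.\<close>

lemma le_on_irreducible:
  assumes W: "irreducible_subspace W" and h: "centralizing W h"
    and t: "t \<noteq> 0" and b: "b \<in> W" "b \<noteq> 0" "\<pi> h b \<le> scale t b"
    and y: "y \<in> W"
  shows "\<pi> h y \<le> scale t y"
proof -
  have hG: "h \<in> carrier G" using h by (simp add: centralizing_def)
  have inv: "invariant_subspace W" using W by (simp add: irreducible_subspace_def)
  let ?U = "{y \<in> W. \<pi> h y \<le> scale t y}"
  have "invariant_subspace ?U" unfolding invariant_subspace_def
  proof (intro conjI allI impI ballI)
    show "Sup X \<in> ?U" if X: "X \<subseteq> ?U" "bdd_above X" for X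
    proof -
      have "X \<subseteq> W" using X by blast
      then have "Sup X \<in> W" using inv X by (simp add: invariant_subspace_def)
      moreover have "Sup (\<pi> h ` X) \<le> scale t (Sup X)"
      proof (cases "X = {}")
        case False
        show ?thesis
        proof (rule cSUP_least[OF False])
          fix z assume z: "z \<in> X"
          then have "\<pi> h z \<le> scale t z" using X by blast
          also have "\<dots> \<le> scale t (Sup X)" by (rule scale_mono_right[OF cSup_upper[OF z X(2)]])
          finally show "\<pi> h z \<le> scale t (Sup X)" .
        qed
      qed (simp add: Sup_empty_eq)
      ultimately show ?thesis using rep_Sup[OF hG X(2)] by simp
    qed
    show "Inf X \<in> ?U" if X: "X \<subseteq> ?U" "X \<noteq> {}" for X
    proof -
      have "X \<subseteq> W" using X by blast
      then have "Inf X \<in> W" using inv X by (simp add: invariant_subspace_def)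
      moreover have "scale (uinv t) (\<pi> h (Inf X)) \<le> Inf X"
      proof (rule cInf_greatest[OF X(2)])
        fix z assume z: "z \<in> X"
        have "\<pi> h (Inf X) \<le> \<pi> h z" by (rule rep_mono[OF hG cInf_lower[OF z]]) simp
        also have "\<dots> \<le> scale t z" using X z by blast
        finally show "scale (uinv t) (\<pi> h (Inf X)) \<le> z" by (simp only: scale_uinv_le_iff[OF t])
      qed
      ultimately show ?thesis by (simp add: scale_uinv_le_iff t)
    qed
    \<comment> \<open>Commutativity of the semifield enters here, exchanging \<open>k\<close> and
      \<open>t\<close>.\<close>
    show "scale k z \<in> ?U" if z: "z \<in> ?U" for k z
    proof -
      have "\<pi> h (scale k z) \<le> scale k (scale t z)"
        using z by (simp add: rep_scale hG scale_mono_right)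
      then show ?thesis using z inv
        by (simp add: invariant_subspace_def scale_scale semifield_mult_commute)
    qed
    show "\<pi> g z \<in> ?U" if g: "g \<in> carrier G" and z: "z \<in> ?U" for g z
    proof -
      have "\<pi> g (\<pi> h z) \<le> \<pi> g (scale t z)" using rep_mono[OF g] z by simp
      then show ?thesis using g z inv h
        by (simp add: invariant_subspace_def rep_scale centralizing_def)
    qed
    show "\<exists>y\<in>?U. y \<noteq> 0" using b by blast
  qed
  moreover have "?U \<subseteq> W" by blast
  ultimately have "?U = W" using W by (simp add: irreducible_subspace_def)
  then show ?thesis using y by blast
qed

lemma rep_funpow_in:
  assumes "invariant_subspace W" "h \<in> carrier G" "y \<in> W"
  shows "(\<pi> h ^^ n) y \<in> W"
  using assms by (induction n) (auto simp: invariant_subspace_def)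

lemma rep_funpow_nonzero: "h \<in> carrier G \<Longrightarrow> y \<noteq> 0 \<Longrightarrow> (\<pi> h ^^ n) y \<noteq> 0"
  by (induction n) (auto simp: rep_eq_zero_iff)

text \<open>The supremum of \<open>t\<^sup>-\<^sup>r h\<^sup>r a\<close> over \<open>r < n\<close> satisfies the inequality, because its first
  term dominates the term for \<open>r = n\<close>.\<close>

lemma le_root_of_gauge:
  assumes W: "irreducible_subspace W" and h: "centralizing W h"
    and n: "n \<noteq> 0" and t: "t ^ n = gauge ((\<pi> h ^^ n) (unit_ball_top W))"
    and y: "y \<in> W"
  shows "\<pi> h y \<le> scale t y"
proof -
  have hG: "h \<in> carrier G" using h by (simp add: centralizing_def)
  have inv: "invariant_subspace W" using W by (simp add: irreducible_subspace_def)
  let ?a = "unit_ball_top W"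
  note a = unit_ball_top_in[OF inv] unit_ball_top_nonzero[OF inv]
  have tn: "t ^ n \<noteq> 0" unfolding t gauge_eq_zero_iff by (rule rep_funpow_nonzero[OF hG a(2)])
  then have t0: "t \<noteq> 0" using n by (auto simp: power_0_left)
  define c where "c r = scale (uinv t ^ r) ((\<pi> h ^^ r) ?a)" for r
  have c_Suc: "\<pi> h (c r) = scale t (c (Suc r))" for r
    by (simp add: c_def rep_scale hG scale_scale uinv_cancel t0)
  have "(\<pi> h ^^ n) ?a \<le> scale (t ^ n) ?a"
    unfolding t by (rule le_scale_unit_ball_top[OF inv rep_funpow_in[OF inv hG a(1)]])
  then have cn: "c n \<le> c 0"
    using scale_uinv_le_iff[OF tn] by (simp add: c_def scale_one uinv_power t0)
  define b where "b = Sup (c ` {..<n})"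
  have bdd: "bdd_above (c ` {..<n})" by simp
  have c_le: "c r \<le> b" if "r < n" for r
    unfolding b_def using that by (intro cSUP_upper[OF _ bdd]) simp
  have c_le': "c (Suc r) \<le> b" if "r < n" for r
  proof (cases "Suc r = n")
    case True
    then show ?thesis using cn c_le[of 0] n by auto
  qed (use c_le that in simp)
  have "\<pi> h b = (SUP r\<in>{..<n}. \<pi> h (c r))"
    unfolding b_def rep_Sup[OF hG bdd] by (simp add: image_image)
  also have "\<dots> \<le> scale t b"
    by (rule cSUP_least) (use n c_le' in \<open>auto simp: c_Suc scale_mono_right\<close>)
  finally have "\<pi> h b \<le> scale t b" .
  moreover have "b \<in> W"
  proof -
    have "c ` {..<n} \<subseteq> W"
      using rep_funpow_in[OF inv hG a(1)] inv by (auto simp: c_def invariant_subspace_def)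
    then show ?thesis using inv bdd by (simp add: b_def invariant_subspace_def)
  qed
  moreover have "b \<noteq> 0"
    using c_le[of 0] n a(2) by (auto simp: c_def scale_one)
  ultimately show ?thesis using le_on_irreducible[OF W h t0] y by blast
qed

definition scalar_on :: "'v set \<Rightarrow> 'g \<Rightarrow> bool"
  where "scalar_on W h \<longleftrightarrow> h \<in> carrier G \<and> (\<exists>c. \<forall>y\<in>W. \<pi> h y = scale c y)"

text \<open>An analogue of Schur's lemma: the best upper scalar \<open>l\<close> for
  \<open>\<pi> h\<close> is also a lower one, because \<open>uinv l\<close> bounds
  \<open>\<pi> (inv h)\<close> at a limit vector \<open>b\<close> and hence, by irreducibility, on
  all of \<open>W\<close>.\<close>

lemma centralizing_imp_scalar_on:
  assumes W: "irreducible_subspace W" and h: "centralizing W h"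
  shows "scalar_on W h"
proof -
  have hG: "h \<in> carrier G" using h by (simp add: centralizing_def)
  have inv: "invariant_subspace W" using W by (simp add: irreducible_subspace_def)
  let ?a = "unit_ball_top W"
  note a = unit_ball_top_in[OF inv] unit_ball_top_nonzero[OF inv]
  let ?T = "{t. \<forall>y\<in>W. \<pi> h y \<le> scale t y}"
  define l where "l = Inf ?T"
  have root: "\<exists>t\<in>?T. t ^ n = gauge ((\<pi> h ^^ n) ?a)" if n: "n \<noteq> 0" for n
  proof -
    obtain t where "t ^ n = gauge ((\<pi> h ^^ n) ?a)"
      using root_exists[of n "gauge ((\<pi> h ^^ n) ?a)"] n by auto
    then show ?thesis using le_root_of_gauge[OF W h n] by blast
  qed
  have T: "?T \<noteq> {}" using root[of 1] by blast
  have le: "\<pi> h y \<le> scale l y" if "y \<in> W" for y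
    unfolding l_def by (rule le_scale_Inf[OF T]) (use that in auto)
  have l0: "l \<noteq> 0"
  proof
    assume "l = 0"
    then have "\<pi> h ?a = 0" using le[OF a(1)] by (simp add: scale_zero_left)
    then show False using a(2) by (simp add: rep_eq_zero_iff hG)
  qed
  \<comment> \<open>Some \<open>n\<close>-th root of this gauge lies in \<open>?T\<close> and is
    therefore at least \<open>l\<close>; this will keep the gauges of the sequence \<open>c\<close>
    above \<open>1\<close>.\<close>
  have l_power: "l ^ n \<le> gauge ((\<pi> h ^^ n) ?a)" for n
  proof (cases "n = 0")
    case True
    then show ?thesis by (simp add: gauge_unit_ball_top inv)
  next
    case False
    then obtain t where t: "t \<in> ?T" "t ^ n = gauge ((\<pi> h ^^ n) ?a)" using root by blast
    then have "l \<le> t" unfolding l_def by (intro cInf_lower) auto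
    then show ?thesis using t power_mono_idem by metis
  qed
  define c where "c r = scale (uinv l ^ r) ((\<pi> h ^^ r) ?a)" for r
  have cW: "c r \<in> W" for r
    using rep_funpow_in[OF inv hG a(1)] inv by (simp add: c_def invariant_subspace_def)
  have c_Suc: "scale l (c (Suc r)) = \<pi> h (c r)" for r
    by (simp add: c_def rep_scale hG scale_scale uinv_cancel l0)
  have "c (Suc r) \<le> c r" for r
  proof -
    have "c (Suc r) = scale (uinv l) (\<pi> h (c r))" by (simp add: scale_uinv l0 flip: c_Suc)
    then show ?thesis using le[OF cW] by (simp add: scale_uinv_le_iff l0)
  qed
  then have dec: "c s \<le> c r" if "r \<le> s" for r s
    using that by (rule lift_Suc_antimono_le)
  define b where "b = Inf (range c)"
  have b_le: "b \<le> c r" for r unfolding b_def by (rule cINF_lower) auto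
  have "gauge b = Inf (gauge ` range c)" unfolding b_def
  proof (rule gauge_Inf_chain)
    show "bdd_above (range c)" using dec[of 0] by (auto intro!: bdd_aboveI[of _ "c 0"])
    show "Complete_Partial_Order.chain (\<le>) (range c)"
      unfolding Complete_Partial_Order.chain_def using dec nat_le_linear by blast
  qed simp
  also have "1 \<le> \<dots>"
  proof (rule cInf_greatest)
    fix k assume "k \<in> gauge ` range c"
    then obtain r where r: "k = gauge (c r)" by blast
    have "uinv l ^ r * l ^ r \<le> uinv l ^ r * gauge ((\<pi> h ^^ r) ?a)"
      by (rule mult_left_mono_idem[OF l_power])
    then show "1 \<le> k"
      by (simp add: r c_def gauge_scale power_nonzero uinv_nonzero l0 uinv flip: uinv_power)
  qed simp
  finally have b0: "b \<noteq> 0" using gauge_eq_zero_iff[of b] by auto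
  have bW: "b \<in> W"
  proof -
    have "range c \<subseteq> W" using cW by blast
    then show ?thesis using inv by (simp add: b_def invariant_subspace_def)
  qed
  \<comment> \<open>Up to the factor \<open>l\<close>, \<open>\<pi> (inv h)\<close> takes
    \<open>c (Suc r)\<close> to \<open>c r\<close>, so its monotonicity alone bounds the value at
    the infimum.\<close>
  have "scale l (\<pi> (inv h) b) \<le> b"
    unfolding b_def
  proof (rule cINF_greatest)
    fix r
    have "\<pi> (inv h) b \<le> \<pi> (inv h) (c (Suc r))" by (rule rep_mono[OF inv_closed[OF hG] b_le])
    then have "scale l (\<pi> (inv h) b) \<le> scale l (\<pi> (inv h) (c (Suc r)))" by (rule scale_mono_right)
    also have "\<dots> = \<pi> (inv h) (scale l (c (Suc r)))" by (simp add: rep_scale hG)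
    also have "\<dots> = c r" by (simp add: c_Suc rep_inv hG)
    finally show "scale l (\<pi> (inv h) (Inf (range c))) \<le> c r" by (simp only: b_def)
  qed simp
  then have "scale (uinv l) (scale l (\<pi> (inv h) b)) \<le> scale (uinv l) b" by (rule scale_mono_right)
  then have "\<pi> (inv h) b \<le> scale (uinv l) b" by (simp only: scale_uinv[OF l0])
  then have inv_le: "\<pi> (inv h) y \<le> scale (uinv l) y" if "y \<in> W" for y
    using le_on_irreducible[OF W centralizing_inv[OF inv h] uinv_nonzero[OF l0] bW b0] that by blast
  have "\<pi> h y = scale l y" if y: "y \<in> W" for y
  proof (rule order.antisym)
    show "\<pi> h y \<le> scale l y" by (rule le[OF y])
    have "\<pi> h (\<pi> (inv h) y) \<le> \<pi> h (scale (uinv l) y)" by (rule rep_mono[OF hG inv_le[OF y]])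
    then have "y \<le> scale (uinv l) (\<pi> h y)" by (simp add: rep_inv rep_scale hG)
    then have "scale l y \<le> scale l (scale (uinv l) (\<pi> h y))" by (rule scale_mono_right)
    then show "scale l y \<le> \<pi> h y" by (simp only: scale_uinv[OF l0])
  qed
  then show ?thesis using hG by (auto simp: scalar_on_def)
qed


section \<open>Descent along the lower central series\<close>

lemma rep_funpow_scale: "h \<in> carrier G \<Longrightarrow> (\<pi> h ^^ n) (scale k y) = scale k ((\<pi> h ^^ n) y)"
  by (induction n) (auto simp: rep_scale)

lemma rep_funpow_mono: "h \<in> carrier G \<Longrightarrow> y \<le> z \<Longrightarrow> (\<pi> h ^^ n) y \<le> (\<pi> h ^^ n) z"
  by (induction n) (auto simp: rep_mono)

text \<open>Conjugating \<open>h\<^sup>n\<close> by \<open>g\<close> multiplies it by \<open>c\<^sup>n\<close> but changes its gauge by at most a factor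
  depending only on \<open>g\<close>.\<close>

lemma twisting_scalar_le_one:
  assumes W: "invariant_subspace W" and g: "g \<in> carrier G" and h: "h \<in> carrier G" and c: "c \<noteq> 0"
    and twist: "\<And>y. y \<in> W \<Longrightarrow> \<pi> g (\<pi> h y) = scale c (\<pi> h (\<pi> g y))"
  shows "c \<le> 1"
proof (rule power_bounded_imp_le_one)
  fix n
  let ?a = "unit_ball_top W"
  note a = unit_ball_top_in[OF W] unit_ball_top_nonzero[OF W]
  let ?r = "gauge (\<pi> (inv g) ?a)"
  let ?z = "(\<pi> h ^^ n) (\<pi> g ?a)"
  have "\<pi> g ((\<pi> h ^^ n) y) = scale (c ^ n) ((\<pi> h ^^ n) (\<pi> g y))" if "y \<in> W" for y
    by (induction n)
      (use that in \<open>auto simp: scale_one twist rep_funpow_in[OF W h] rep_scale h scale_scale\<close>)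
  then have z: "\<pi> g ((\<pi> h ^^ n) ?a) = scale (c ^ n) ?z" using a(1) by blast
  have r: "?r \<noteq> 0" using a(2) by (simp add: gauge_eq_zero_iff rep_eq_zero_iff g)
  have "\<pi> (inv g) ?a \<le> scale ?r ?a"
    using W a(1) g by (intro le_scale_unit_ball_top) (auto simp: invariant_subspace_def)
  then have "\<pi> g (\<pi> (inv g) ?a) \<le> \<pi> g (scale ?r ?a)" by (rule rep_mono[OF g])
  then have "?a \<le> scale ?r (\<pi> g ?a)" by (simp add: rep_inv rep_scale g)
  then have "(\<pi> h ^^ n) ?a \<le> scale ?r ?z"
    using rep_funpow_mono[OF h, of ?a "scale ?r (\<pi> g ?a)" n] by (simp add: rep_funpow_scale h)
  then have "gauge ((\<pi> h ^^ n) ?a) \<le> ?r * gauge ?z"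
    using gauge_mono gauge_scale[OF r] by metis
  then have "gauge ((\<pi> h ^^ n) ?a) * gauge (\<pi> g e) \<le> ?r * gauge ?z * gauge (\<pi> g e)"
    by (rule mult_right_mono_idem)
  then have "c ^ n * gauge ?z \<le> ?r * gauge ?z * gauge (\<pi> g e)"
    using gauge_rep_le[OF g, of "(\<pi> h ^^ n) ?a"] gauge_scale[OF power_nonzero[OF c], of n ?z]
    by (simp add: z)
  \<comment> \<open>Commutativity moves \<open>gauge ?z\<close> to the end, where it cancels and
    leaves a bound independent of \<open>n\<close>.\<close>
  also have "\<dots> = ?r * gauge (\<pi> g e) * gauge ?z"
    by (metis mult.assoc semifield_mult_commute)
  finally have "c ^ n * gauge ?z * uinv (gauge ?z) \<le>
      ?r * gauge (\<pi> g e) * gauge ?z * uinv (gauge ?z)"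
    by (rule mult_right_mono_idem)
  moreover have z0: "gauge ?z \<noteq> 0"
    using a(2) by (simp add: gauge_eq_zero_iff rep_funpow_nonzero rep_eq_zero_iff g h)
  ultimately show "c ^ n \<le> ?r * gauge (\<pi> g e)" by (simp only: uinv_cancel[OF z0])
qed

text \<open>The commutator acts by a scalar \<open>c\<close>. The bound for twisting scalars,
  applied to \<open>g\<close> and to \<open>inv g\<close>, gives \<open>c \<le> 1\<close> and
  \<open>uinv c \<le> 1\<close>.\<close>

lemma scalar_commutators_imp_centralizing:
  assumes W: "invariant_subspace W" and h: "h \<in> carrier G"
    and comm: "\<And>g. g \<in> carrier G \<Longrightarrow> scalar_on W (inv g \<otimes> inv h \<otimes> g \<otimes> h)"
  shows "centralizing W h"
  unfolding centralizing_def
proof (intro conjI ballI)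
  note a = unit_ball_top_in[OF W] unit_ball_top_nonzero[OF W]
  fix g y assume g: "g \<in> carrier G" and y: "y \<in> W"
  let ?k = "inv g \<otimes> inv h \<otimes> g \<otimes> h"
  have k: "?k \<in> carrier G" using g h by simp
  obtain c where c: "\<And>y. y \<in> W \<Longrightarrow> \<pi> ?k y = scale c y"
    using comm[OF g] by (auto simp: scalar_on_def)
  have "c \<noteq> 0"
  proof
    assume "c = 0"
    then have "\<pi> ?k (unit_ball_top W) = 0" using c[OF a(1)] by (simp add: scale_zero_left)
    then show False using a(2) rep_eq_zero_iff[OF k] by blast
  qed
  have cancel: "u \<otimes> (inv u \<otimes> v) = v" if "u \<in> carrier G" "v \<in> carrier G" for u v
    using that by (simp flip: m_assoc)
  have "h \<otimes> g \<otimes> ?k = g \<otimes> h"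
    using g h by (simp add: m_assoc cancel)
  then have twist: "\<pi> g (\<pi> h y) = scale c (\<pi> h (\<pi> g y))" if "y \<in> W" for y
  proof -
    have "\<pi> g (\<pi> h y) = \<pi> (h \<otimes> g \<otimes> ?k) y"
      unfolding \<open>h \<otimes> g \<otimes> ?k = g \<otimes> h\<close> by (rule rep_mult[OF g h, symmetric])
    also have "\<dots> = \<pi> h (\<pi> g (\<pi> ?k y))" using rep_mult[OF m_closed[OF h g] k] g h by (simp add: rep_mult)
    also have "\<dots> = scale c (\<pi> h (\<pi> g y))" by (simp only: c[OF that] rep_scale[OF g] rep_scale[OF h])
    finally show ?thesis .
  qed
  then have "c \<le> 1" using twisting_scalar_le_one[OF W g h \<open>c \<noteq> 0\<close>] by blast
  moreover have "uinv c \<le> 1"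
  proof (rule twisting_scalar_le_one[OF W inv_closed[OF g] h uinv_nonzero[OF \<open>c \<noteq> 0\<close>]])
    fix y assume "y \<in> W"
    then have y': "\<pi> (inv g) y \<in> W" using W g by (simp add: invariant_subspace_def)
    have "scale c (\<pi> h y) = \<pi> g (\<pi> h (\<pi> (inv g) y))" using twist[OF y'] by (simp add: rep_inv g)
    then have "\<pi> (inv g) (scale c (\<pi> h y)) = \<pi> h (\<pi> (inv g) y)" by (simp add: rep_inv g)
    then show "\<pi> (inv g) (\<pi> h y) = scale (uinv c) (\<pi> h (\<pi> (inv g) y))"
      using g \<open>c \<noteq> 0\<close> by (metis inv_closed rep_scale scale_uinv(1))
  qed
  then have "1 \<le> c" using uinv_left_le_iff[OF \<open>c \<noteq> 0\<close>, of 1 1] by simp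
  ultimately have "c = 1" by simp
  then show "\<pi> g (\<pi> h y) = \<pi> h (\<pi> g y)" using twist[OF y] by (simp add: scale_one)
qed (rule h)

lemma lower_central_subset: "lower_central G n \<subseteq> carrier G"
proof (induction n)
  case (Suc n)
  then show ?case unfolding lower_central.simps commutator_subgroup_def
    by (intro generate_incl) auto
qed simp

text \<open>Commutators with members of term \<open>n\<close> lie in term \<open>Suc n\<close> and
  act by scalars, so these members are centralizing and hence scalar. At index \<open>0\<close> the
  term is the whole group.\<close>

lemma scalar_on_lower_central:
  assumes W: "irreducible_subspace W"
  shows "\<forall>h\<in>lower_central G n. scalar_on W h \<Longrightarrow> g \<in> carrier G \<Longrightarrow> scalar_on W g"
proof (induction n)
  case (Suc n)
  have "scalar_on W h" if h: "h \<in> lower_central G n" for h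
  proof (rule centralizing_imp_scalar_on[OF W], rule scalar_commutators_imp_centralizing)
    show "invariant_subspace W" using W by (simp add: irreducible_subspace_def)
    show "h \<in> carrier G" using h lower_central_subset by blast
    fix x assume "x \<in> carrier G"
    then have "inv x \<otimes> inv h \<otimes> x \<otimes> h \<in> lower_central G (Suc n)"
      using h unfolding lower_central.simps commutator_subgroup_def by (intro generate.incl) blast
    then show "scalar_on W (inv x \<otimes> inv h \<otimes> x \<otimes> h)" using Suc.prems(1) by blast
  qed
  then show ?case using Suc by blast
qed simp

end

theorem theorem5:
  fixes scale :: "'k::{b_complete_semifield, algebraically_closed_semiring} \<Rightarrow>
      'v::b_complete_semigroup \<Rightarrow> 'v"
    and G :: "('g, 'm) monoid_scheme"
    and \<pi> :: "'g \<Rightarrow> 'v \<Rightarrow> 'v"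
  assumes "archimedean_b_space scale"
    and "\<exists>v::'v. v \<noteq> 0"
    and "nilpotent_group G"
    and "linear_representation G scale \<pi>"
  shows "\<exists>(a::'v) (l::'g \<Rightarrow> 'k). a \<noteq> 0 \<and> (\<forall>g\<in>carrier G. \<pi> g a = scale (l g) a)"
proof -
  interpret archimedean_b_space scale by (rule assms(1))
  obtain e where "wo_continuous_archimedean_element e" using ex_wo_continuous_archimedean by blast
  then interpret archimedean_representation scale G \<pi> e
    using assms by (intro archimedean_representation.intro archimedean_representation_axioms.intro)
      (auto simp: nilpotent_group_def idempotent_b_space_axioms)
  obtain n where n: "lower_central G n = {\<one>\<^bsub>G\<^esub>}" using assms(3) by (auto simp: nilpotent_group_def)
  obtain W where W: "irreducible_subspace W" using ex_irreducible_subspace by blast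
  have "\<forall>y\<in>W. \<pi> \<one>\<^bsub>G\<^esub> y = scale 1 y" by (simp add: rep_one scale_one)
  then have "\<forall>h\<in>lower_central G n. scalar_on W h" using n by (auto simp: scalar_on_def)
  then have "\<forall>g\<in>carrier G. \<exists>c. \<forall>y\<in>W. \<pi> g y = scale c y"
    using scalar_on_lower_central[OF W] by (auto simp: scalar_on_def)
  then obtain l where "\<forall>g\<in>carrier G. \<forall>y\<in>W. \<pi> g y = scale (l g) y" by metis
  \<comment> \<open>Any nonzero vector of \<open>W\<close> is now a joint eigenvector.\<close>
  moreover have "unit_ball_top W \<in> W" "unit_ball_top W \<noteq> 0"
    using W unit_ball_top_in unit_ball_top_nonzero by (auto simp: irreducible_subspace_def)
  ultimately show ?thesis by blast
qed

end
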